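(* Let $a,b$ be integers such that $\Delta=a^2+4b$ is not a square and $\gcd(a,a^2+2b)=1$. Let $u=(u_n)_{n\ge1}$ be a sequence of non-negative integers with $u_1,u_2\ge1$ satisfying the recurrence $$u_{n+2}=au_{n+1}+bu_n\quad\text{for all } n\ge1.$$ Then $u\in\mathcal{ER}$ if and only if $\dfrac{u_2}{u_1}=\dfrac{a^2+2b}{a}$.
   Context: For a map $T:X\to X$ on a set $X$ and $n\ge 1$, let $f_n(T)=\#\{x\in X\mid T^n x=x\}$ be the number of points with period $n$; all maps considered are assumed to have $f_n(T)$ finite for every $n\ge1$. A sequence $\phi=(\phi_n)_{n\ge1}$ of non-negative integers is exactly realizable, written $\phi\in\mathcal{ER}$, if there is a set $X$ and a map $T:X\to X$ with $f_n(T)=\phi_n$ for all $n\ge1$. (The hypothesis $\gcd(a,a^2+2b)=1$ forces $a\neq0$, so the ratio on the right is defined.) *)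

theory Defs
  imports Complex_Main "HOL-Library.Countable_Set" "HOL-Library.FuncSet"
begin

text \<open>Points of \<open>X\<close> with (not necessarily least) period \<open>n\<close> under \<open>T\<close>.\<close>

definition period_points :: "'a set \<Rightarrow> ('a \<Rightarrow> 'a) \<Rightarrow> nat \<Rightarrow> 'a set" where
  "period_points X T n = {x \<in> X. (T ^^ n) x = x}"

text \<open>Sequences are indexed by \<open>n \<ge> 1\<close>; the value \<open>\<phi> 0\<close> is ignored. Finiteness is
  stated separately because \<open>card\<close> of an infinite set is \<open>0\<close>.\<close>

definition realizes :: "'a set \<Rightarrow> ('a \<Rightarrow> 'a) \<Rightarrow> (nat \<Rightarrow> nat) \<Rightarrow> bool" where
  "realizes X T \<phi> \<longleftrightarrow> T \<in> X \<rightarrow> X \<and>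
     (\<forall>n\<ge>1. finite (period_points X T n) \<and> card (period_points X T n) = \<phi> n)"

text \<open>HOL cannot quantify existentially over types, so \<open>X\<close> ranges over sets of natural
  numbers. This is no restriction: \<open>realizes_imp_ER\<close> below shows that a system on a set of
  arbitrary type and cardinality gives a member of \<open>ER\<close>.\<close>

definition ER :: "(nat \<Rightarrow> nat) set" where
  "ER = {\<phi>. \<exists>(X :: nat set) T. realizes X T \<phi>}"

lemma realizes_imp_ER:
  fixes X :: "'a set"
  assumes "realizes X T \<phi>"
  shows "\<phi> \<in> ER"
proof -
  define P where "P = (\<Union>n\<in>{1..}. period_points X T n)"
  have TX: "T \<in> X \<rightarrow> X" and fin: "\<And>n. n \<ge> 1 \<Longrightarrow> finite (period_points X T n)"
    and crd: "\<And>n. n \<ge> 1 \<Longrightarrow> card (period_points X T n) = \<phi> n"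
    using assms by (auto simp: realizes_def)
  have "countable P"
    unfolding P_def by (intro countable_UN) (simp_all add: countable_finite fin)
  then obtain f :: "'a \<Rightarrow> nat" where inj: "inj_on f P"
    by (auto simp: countable_def)
  have TP: "T x \<in> P" if "x \<in> P" for x
  proof -
    from that obtain n where n: "n \<ge> 1" "x \<in> X" "(T ^^ n) x = x"
      by (auto simp: P_def period_points_def)
    have "(T ^^ n) (T x) = T x"
      using n(3) by (metis funpow_swap1)
    then show ?thesis
      using n TX by (auto simp: P_def period_points_def)
  qed
  have iterP: "(T ^^ n) x \<in> P" if "x \<in> P" for x n
    by (induction n) (use that TP in auto)
  define S where "S = (\<lambda>k. f (T (inv_into P f k)))"
  have S: "(S ^^ n) (f x) = f ((T ^^ n) x)" if "x \<in> P" for x n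
    by (induction n) (use that iterP inj in \<open>auto simp: S_def\<close>)
  have sub: "period_points X T n \<subseteq> P" if "n \<ge> 1" for n
    using that by (auto simp: P_def)
  have eq: "period_points (f ` P) S n = f ` period_points X T n" if n: "n \<ge> 1" for n
  proof -
    have "(S ^^ n) (f x) = f x \<longleftrightarrow> x \<in> period_points X T n" if "x \<in> P" for x
    proof -
      have "(S ^^ n) (f x) = f x \<longleftrightarrow> (T ^^ n) x = x"
        using S[OF that] iterP[OF that] inj that by (auto dest: inj_onD)
      moreover have "x \<in> X"
        using that by (auto simp: P_def period_points_def)
      ultimately show ?thesis
        by (simp add: period_points_def)
    qed
    then show ?thesis
      using sub[OF n] unfolding period_points_def[of "f ` P"] by blast
  qed
  have "S \<in> f ` P \<rightarrow> f ` P"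
    using TP inj by (auto simp: S_def)
  moreover have "finite (period_points (f ` P) S n) \<and> card (period_points (f ` P) S n) = \<phi> n"
    if "n \<ge> 1" for n
    using eq[OF that] fin[OF that] crd[OF that] card_image[OF inj_on_subset[OF inj sub[OF that]]]
    by simp
  ultimately have "realizes (f ` P) S \<phi>"
    by (simp add: realizes_def)
  then show ?thesis
    by (auto simp: ER_def)
qed

end

theory Submission
  imports Defs
    "HOL-Number_Theory.Number_Theory"
    "HOL-Computational_Algebra.Formal_Power_Series"
    "HOL-Computational_Algebra.Nth_Powers"
begin

text \<open>
  Let \<open>\<lambda>\<close> and \<open>\<mu>\<close> be the roots of \<open>x\<^sup>2 - a x - b\<close> and \<open>\<Delta> = a\<^sup>2 + 4 b\<close>. If
  \<open>\<Delta> < 0\<close>, every non-zero solution changes sign, so non-negativity of \<open>u\<close> forces \<open>\<Delta> > 0\<close>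
  (\<open>discriminant_nonneg\<close>). Write \<open>u n = \<alpha> \<lambda>\<^sup>n + \<beta> \<mu>\<^sup>n\<close>. The integer
  \<open>c = a u 2 - (a\<^sup>2 + 2 b) u 1\<close> equals \<open>b (\<lambda> - \<mu>) (\<beta> - \<alpha>)\<close>, so the condition on the ratio says
  that \<open>\<alpha> = \<beta>\<close>, that is, that \<open>u\<close> is a multiple of the trace sequence \<open>\<lambda>\<^sup>n + \<mu>\<^sup>n\<close>.

  Necessity. For a realizable sequence and a prime \<open>p\<close>, the points of period \<open>p\<close> that are not
  fixed fall into cycles of length \<open>p\<close>, so \<open>u p \<equiv> u 1\<close> modulo \<open>p\<close> (\<open>ER_prime_congruence\<close>). If
  \<open>\<Delta>\<close> is a non-residue modulo an odd prime \<open>p\<close>, the Frobenius map exchanges \<open>\<lambda>\<close> and \<open>\<mu>\<close>, so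
  \<open>u p \<equiv> \<alpha> \<mu> + \<beta> \<lambda>\<close> (\<open>recurrence_at_inert_prime\<close>). Comparing the two congruences gives that
  \<open>p\<close> divides \<open>c\<close>. If \<open>c\<close> were not zero, then \<open>\<Delta> c\<^sup>2\<close> would be a positive non-square, and
  quadratic reciprocity provides an odd prime modulo which it is a non-residue
  (\<open>exists_inert_prime_nat\<close>); this prime does not divide \<open>c\<close> and \<open>\<Delta>\<close> is a non-residue
  modulo it, a contradiction.

  Sufficiency. The gcd condition turns the ratio into \<open>u n = k V n\<close> with an integer \<open>k\<close> and the
  trace sequence \<open>V\<close>. Decompose \<open>V n\<close> as the sum of \<open>h d\<close> over the divisors \<open>d\<close> of \<open>n\<close>. A
  system that realizes \<open>u\<close> must have \<open>k h n / n\<close> cycles of length \<open>n\<close>, and conversely a disjoint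
  union of that many cycles realizes \<open>u\<close> (\<open>ER_of_cycle_counts\<close>). It remains to see that this
  number is an integer and not negative. Integrality: \<open>V\<close> is the sequence of coefficients of
  \<open>-X F'/F\<close> for \<open>F = 1 - a X - b X\<^sup>2\<close>, every integer power series with constant term \<open>1\<close> is a
  product of integer powers of the series \<open>1 - X\<^sup>d\<close>, and such a factorization exhibits \<open>h d / d\<close> as
  exponents (\<open>logderiv_Gauss_congruence\<close>). Non-negativity: \<open>u (n + 2) \<ge> u (n + 1) + u n\<close>, so
  \<open>u n\<close> is at least the sum of all \<open>u d\<close> with \<open>d\<close> a proper divisor of \<open>n\<close>
  (\<open>orbit_count_nonneg\<close>).
\<close>

unbundle fps_syntax

section \<open>Periodic points and orbit counts\<close>

text \<open>
  The witness is the disjoint union of \<open>c d\<close> cycles of length \<open>d\<close> for every \<open>d\<close>: the point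
  \<open>(d, i, j)\<close> is the \<open>j\<close>-th point of the \<open>i\<close>-th cycle of length \<open>d\<close>, and \<open>T\<^sup>n\<close> fixes it exactly
  when \<open>d\<close> divides \<open>n\<close>.
\<close>

lemma ER_of_cycle_counts:
  fixes \<phi> c :: "nat \<Rightarrow> nat"
  assumes c: "\<And>n. n \<ge> 1 \<Longrightarrow> \<phi> n = (\<Sum>d | d dvd n. d * c d)"
  shows "\<phi> \<in> ER"
proof -
  define X where "X = {(d, i, j). i < c d \<and> j < (d::nat)}"
  define T where "T = (\<lambda>(d, i, j). (d, i :: nat, Suc j mod d))"
  have iter: "(T ^^ n) (d, i, j) = (d, i, (j + n) mod d)" if "j < d" for n d i j
    using that by (induction n) (auto simp: T_def mod_Suc_eq)
  have eq: "period_points X T n = (SIGMA d:{d. d dvd n}. {..<c d} \<times> {..<d})" if "n \<ge> 1" for n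
  proof -
    have "(j + n) mod d = j \<longleftrightarrow> d dvd n" if "j < d" for j d :: nat
    proof -
      have "(j + n) mod d = j \<longleftrightarrow> [j + n = j + 0] (mod d)"
        using that by (simp add: cong_def)
      also have "\<dots> \<longleftrightarrow> d dvd n"
        by (simp only: cong_add_lcancel_nat cong_0_iff)
      finally show ?thesis .
    qed
    then show ?thesis
      using iter by (auto simp: period_points_def X_def)
  qed
  have "realizes X T \<phi>"
    unfolding realizes_def
  proof (intro conjI allI impI)
    show "T \<in> X \<rightarrow> X" by (auto simp: X_def T_def)
    fix n :: nat assume n: "n \<ge> 1"
    then have fin: "finite {d. d dvd n}" by simp
    show "finite (period_points X T n)"
      unfolding eq[OF n] using fin by auto
    show "card (period_points X T n) = \<phi> n"
      unfolding eq[OF n] c[OF n] using fin by (simp add: card_SigmaI mult.commute)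
  qed
  then show ?thesis by (rule realizes_imp_ER)
qed

text \<open>
  The map \<open>T\<close> generates an action of the cyclic group of order \<open>p\<close>. As \<open>p\<close> is prime, a point that
  is not fixed by \<open>T\<close> has an orbit of exactly \<open>p\<close> points. The induction removes one orbit at a
  time.
\<close>

lemma prime_dvd_card_of_free_cyclic_action:
  assumes "prime (p::nat)" "finite Y" "T ` Y \<subseteq> Y"
    and "\<And>y. y \<in> Y \<Longrightarrow> (T ^^ p) y = y" "\<And>y. y \<in> Y \<Longrightarrow> T y \<noteq> y"
  shows "p dvd card Y"
  using assms(2-)
proof (induction "card Y" arbitrary: Y rule: less_induct)
  case less
  note fin = less.prems(1) and inv = less.prems(2) and per = less.prems(3) and free = less.prems(4)
  show ?case
  proof (cases "Y = {}")
    case False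
    then obtain y where y: "y \<in> Y" by blast
    define orb where "orb = (\<lambda>i. (T ^^ i) y) ` {..<p}"
    have iterY: "(T ^^ i) z \<in> Y" if "z \<in> Y" for i z
      using that inv by (induction i) auto
    have mult: "(T ^^ (k * p)) z = z" if "z \<in> Y" for k z
      using that per by (induction k) (auto simp: funpow_add)
    have modp: "(T ^^ i) z = (T ^^ (i mod p)) z" if "z \<in> Y" for i z
    proof -
      have "(T ^^ i) z = (T ^^ (i mod p + (i div p) * p)) z" by simp
      also have "\<dots> = (T ^^ (i mod p)) z" using mult[OF that] by (simp only: funpow_add o_apply)
      finally show ?thesis .
    qed
    have ge: "p > 0" "p > 1" using assms(1) prime_gt_0_nat prime_gt_1_nat by auto
    have no: "(T ^^ i) z \<noteq> z" if "z \<in> Y" "0 < i" "i < p" for i z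
    proof
      assume fixed: "(T ^^ i) z = z"
      \<comment> \<open>A multiple of \<open>i\<close> is \<open>1\<close> modulo \<open>p\<close>, so \<open>T\<close> itself would fix \<open>z\<close>.\<close>
      have "\<not> p dvd i" using that(2,3) by (auto dest: dvd_imp_le)
      then have "coprime i p" using assms(1) prime_imp_coprime coprime_commute by blast
      then obtain k where k: "[i * k = Suc 0] (mod p)" using cong_solve_coprime_nat by blast
      have "(T ^^ (k * i)) z = z" for k
        using fixed by (induction k) (auto simp: funpow_add)
      from this[of k] have "(T ^^ (i * k)) z = z" by (simp only: mult.commute)
      moreover have "(T ^^ (i * k)) z = T z"
        using modp[OF that(1), of "i * k"] k ge by (simp add: cong_def)
      ultimately show False using free that(1) by auto
    qed
    have inj: "inj_on (\<lambda>i. (T ^^ i) y) {..<p}"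
    proof (rule linorder_inj_onI)
      fix i j assume ij: "i < j" "i \<in> {..<p}" "j \<in> {..<p}"
      have "(T ^^ j) y = (T ^^ (j - i)) ((T ^^ i) y)"
        using ij funpow_add[of "j - i" i T] by (simp del: funpow.simps)
      then show "(T ^^ i) y \<noteq> (T ^^ j) y"
        using no[OF iterY[OF y, of i], of "j - i"] ij less_imp_diff_less[of j p i] by auto
    qed auto
    then have cardO: "card orb = p" by (simp add: orb_def card_image)
    have OY: "orb \<subseteq> Y" using iterY y by (auto simp: orb_def)
    have inO: "(T ^^ i) y \<in> orb" for i
      using modp[OF y, of i] ge by (auto simp: orb_def intro!: image_eqI[of _ _ "i mod p"])
    \<comment> \<open>The complement of the orbit is invariant because \<open>T\<close> can be undone by \<open>T\<^sup>p\<^sup>-\<^sup>1\<close>.\<close>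
    have backO: "z \<in> orb" if z: "z \<in> Y" "T z \<in> orb" for z
    proof -
      obtain i where "T z = (T ^^ i) y" using z(2) unfolding orb_def by blast
      then have "(T ^^ (p - 1)) (T z) = (T ^^ (p - 1 + i)) y" by (simp add: funpow_add)
      moreover have "(T ^^ (p - 1)) (T z) = (T ^^ p) z"
        using ge by (cases p) (simp_all only: funpow_Suc_right o_apply diff_Suc_1)
      ultimately show ?thesis using per[OF z(1)] inO[of "p - 1 + i"] by simp
    qed
    have fO: "finite orb" by (simp add: orb_def)
    have cY: "card Y = card (Y - orb) + p"
      using OY fin cardO card_Diff_subset[OF fO OY] card_mono[OF fin OY] by simp
    have "p dvd card (Y - orb)"
    proof (rule less.hyps)
      show "card (Y - orb) < card Y" using cY ge by simp
      show "T ` (Y - orb) \<subseteq> Y - orb" using inv backO by blast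
    qed (use fin per free in auto)
    then show ?thesis using cY by simp
  qed simp
qed

lemma ER_prime_congruence:
  assumes "\<phi> \<in> ER" "prime p"
  shows "int p dvd int (\<phi> p) - int (\<phi> 1)"
proof -
  obtain X :: "nat set" and T where XT: "realizes X T \<phi>"
    using assms(1) by (auto simp: ER_def)
  have p: "p \<ge> 1" using prime_gt_0_nat[OF assms(2)] by simp
  define P1 where "P1 = period_points X T 1"
  define Pp where "Pp = period_points X T p"
  have fp: "T \<in> X \<rightarrow> X" "finite P1" "finite Pp" "card P1 = \<phi> 1" "card Pp = \<phi> p"
    using XT p by (auto simp: realizes_def P1_def Pp_def)
  have "(T ^^ n) x = x" if "T x = x" for n x
    using that by (induction n) auto
  then have sub: "P1 \<subseteq> Pp"
    by (auto simp: P1_def Pp_def period_points_def)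
  have "p dvd card (Pp - P1)"
  proof (rule prime_dvd_card_of_free_cyclic_action[OF assms(2)])
    have "(T ^^ p) (T x) = T ((T ^^ p) x)" for x by (simp add: funpow_swap1)
    moreover have "T x \<in> X - P1" if "x \<in> Pp - P1" for x
    proof -
      have x: "x \<in> X" "(T ^^ p) x = x" "T x \<noteq> x"
        using that by (auto simp: P1_def Pp_def period_points_def)
      have "T (T x) \<noteq> T x"
      proof
        assume fixed: "T (T x) = T x"
        have "(T ^^ n) (T x) = T x" for n using fixed by (induction n) auto
        moreover have "(T ^^ (p - 1)) (T x) = (T ^^ p) x"
          using p by (cases p) (simp_all only: funpow_Suc_right o_apply diff_Suc_1)
        ultimately show False using x by metis
      qed
      then show ?thesis using x fp(1) by (auto simp: P1_def period_points_def)
    qed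
    ultimately show "T ` (Pp - P1) \<subseteq> Pp - P1"
      by (auto simp: Pp_def period_points_def)
  qed (use fp in \<open>auto simp: Pp_def P1_def period_points_def\<close>)
  then show ?thesis
    using sub fp card_Diff_subset[OF fp(2) sub] card_mono[OF fp(3) sub]
    by (metis of_nat_diff of_nat_dvd_iff)
qed

section \<open>Gauss congruences from integer power series\<close>

text \<open>
  The series \<open>-X (d/dX) log (1 - X\<^sup>d)\<close>, with \<open>d\<close> at the positive multiples of \<open>d\<close>: its \<open>n\<close>-th
  coefficient is the number of points of period \<open>n\<close> on a single cycle of length \<open>d\<close>.
\<close>

definition cycle_series :: "nat \<Rightarrow> int fps" where
  "cycle_series d = Abs_fps (\<lambda>n. if n > 0 \<and> d dvd n then int d else 0)"

text \<open>
  The equation \<open>X F' = S F\<close> says that \<open>S\<close> is the logarithmic derivative \<open>X F'/F\<close>; in this form it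
  makes sense over the integers without division. Logarithmic derivatives turn products into sums.
\<close>

lemma logderiv_mult:
  fixes F G S R :: "int fps"
  assumes "fps_X * fps_deriv F = S * F" "fps_X * fps_deriv G = R * G"
  shows "fps_X * fps_deriv (F * G) = (S + R) * (F * G)"
proof -
  have "fps_X * fps_deriv (F * G) = F * (fps_X * fps_deriv G) + (fps_X * fps_deriv F) * G"
    by (simp add: algebra_simps)
  then show ?thesis using assms by (simp add: algebra_simps)
qed

lemma logderiv_power:
  fixes F S :: "int fps"
  assumes "fps_X * fps_deriv F = S * F"
  shows "fps_X * fps_deriv (F ^ k) = (of_nat k * S) * F ^ k"
proof (induction k)
  case (Suc k)
  from logderiv_mult[OF assms Suc] show ?case by (simp add: algebra_simps)
qed simp

lemma cycle_series_mult:
  assumes "d > 0"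
  shows "cycle_series d * (1 - fps_X ^ d) = of_nat d * fps_X ^ d"
proof (rule fps_ext)
  fix n
  have "(cycle_series d * (1 - fps_X ^ d)) $ n
      = cycle_series d $ n - (if n < d then 0 else cycle_series d $ (n - d))"
    by (simp add: right_diff_distrib fps_X_power_mult_right_nth)
  also have "\<dots> = (if n = d then int d else 0)"
    using assms by (auto simp: cycle_series_def dvd_diff_nat dest: nat_dvd_not_less dvd_diffD)
  also have "\<dots> = ((of_nat d * fps_X ^ d) :: int fps) $ n"
    by (simp add: fps_of_nat[symmetric] fps_X_power_nth)
  finally show "(cycle_series d * (1 - fps_X ^ d)) $ n = ((of_nat d * fps_X ^ d) :: int fps) $ n" .
qed

lemma fps_X_times_deriv_X_power:
  "fps_X * fps_deriv (fps_X ^ d) = (of_nat d * fps_X ^ d :: int fps)"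
  by (rule fps_ext) (auto simp: fps_of_nat[symmetric] fps_X_power_nth)

lemma logderiv_one_minus_X_power:
  assumes "d > 0"
  shows "fps_X * fps_deriv (1 - fps_X ^ d) = - cycle_series d * (1 - fps_X ^ d)"
  using cycle_series_mult[OF assms] fps_X_times_deriv_X_power[of d] by (simp del: fps_deriv_power)

text \<open>
  The series is the geometric series \<open>1 / (1 - X\<^sup>d)\<close>. It supplies the negative powers of
  \<open>1 - X\<^sup>d\<close> in the factorization of integer power series.
\<close>

lemma logderiv_geometric:
  assumes "d > 0"
  shows "\<exists>G :: int fps. G $ 0 = 1 \<and> fps_X * fps_deriv G = cycle_series d * G"
proof -
  define P :: "int fps" where "P = 1 - fps_X ^ d"
  define G :: "int fps" where "G = Abs_fps (\<lambda>n. if d dvd n then 1 else 0)"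
  have GP: "G * P = 1"
  proof (rule fps_ext)
    fix n
    have "(G * P) $ n = G $ n - (if n < d then 0 else G $ (n - d))"
      by (simp add: P_def right_diff_distrib fps_X_power_mult_right_nth)
    also have "\<dots> = (if n = 0 then 1 else 0)"
      using assms by (auto simp: G_def dvd_diff_nat dest: nat_dvd_not_less dvd_diffD)
    finally show "(G * P) $ n = (1 :: int fps) $ n" by simp
  qed
  have "fps_X * fps_deriv G * P + G * (fps_X * fps_deriv P) = fps_X * fps_deriv (G * P)"
    by (simp add: algebra_simps)
  also have "\<dots> = 0" by (simp add: GP)
  finally have "fps_X * fps_deriv G * P = - G * (fps_X * fps_deriv P)"
    by (simp add: eq_neg_iff_add_eq_0)
  also have "\<dots> = G * cycle_series d * P"
    using logderiv_one_minus_X_power[OF assms] by (simp add: P_def)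
  finally have "fps_X * fps_deriv G * (G * P) = cycle_series d * G * (G * P)"
    by (simp add: mult_ac)
  then have "fps_X * fps_deriv G = cycle_series d * G"
    by (simp add: GP)
  moreover have "G $ 0 = 1" by (simp add: G_def)
  ultimately show ?thesis by blast
qed

lemma logderiv_cycle_factor:
  assumes "d > 0"
  shows "\<exists>G :: int fps. G $ 0 = 1 \<and> fps_X * fps_deriv G = of_int c * cycle_series d * G"
proof (cases "c \<ge> 0")
  case True
  obtain G :: "int fps" where "G $ 0 = 1" "fps_X * fps_deriv G = cycle_series d * G"
    using logderiv_geometric[OF assms] by blast
  then show ?thesis
    using True logderiv_power[of G "cycle_series d" "nat c"]
    by (intro exI[of _ "G ^ nat c"]) (simp add: fps_power_zeroth)
next
  case False
  then have "fps_X * fps_deriv ((1 - fps_X ^ d) ^ nat (- c))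
      = of_int c * cycle_series d * (1 - fps_X ^ d) ^ nat (- c)"
    using logderiv_power[OF logderiv_one_minus_X_power[OF assms], of "nat (- c)"]
    by simp
  then show ?thesis
    using assms by (intro exI[of _ "(1 - fps_X ^ d) ^ nat (- c)"]) (simp add: fps_power_zeroth zero_power)
qed

text \<open>
  Multiplying \<open>F\<close> by integer powers of the series \<open>1 - X\<^sup>d\<close> subtracts any chosen integer
  combination of the cycle series from its logarithmic derivative, and leaves \<open>F\<close> an integer
  series with constant term \<open>1\<close>.
\<close>

lemma logderiv_remove_cycles:
  fixes F S :: "int fps" and c :: "nat \<Rightarrow> int"
  assumes "F $ 0 = 1" "fps_X * fps_deriv F = S * F" "finite D" "\<And>d. d \<in> D \<Longrightarrow> d > 0"
  shows "\<exists>G :: int fps. G $ 0 = 1 \<and>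
           fps_X * fps_deriv G = (S - (\<Sum>d\<in>D. of_int (c d) * cycle_series d)) * G"
  using assms(3,4)
proof (induction D)
  case empty
  then show ?case using assms(1,2) by auto
next
  case (insert e D)
  then obtain G :: "int fps" where G: "G $ 0 = 1"
    "fps_X * fps_deriv G = (S - (\<Sum>d\<in>D. of_int (c d) * cycle_series d)) * G"
    by auto
  obtain H :: "int fps" where H: "H $ 0 = 1"
    "fps_X * fps_deriv H = of_int (- c e) * cycle_series e * H"
    using logderiv_cycle_factor[of e "- c e"] insert.prems by auto
  show ?case
    using logderiv_mult[OF G(2) H(2)] G(1) H(1) insert.hyps
    by (intro exI[of _ "G * H"]) (simp add: algebra_simps)
qed

text \<open>
  The source of all divisibility in the sufficiency part: the \<open>n\<close>-th coefficient of \<open>X F'\<close> is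
  \<open>n\<close> times an integer, and when the lower coefficients of \<open>R\<close> vanish, the \<open>n\<close>-th coefficient of
  \<open>R F\<close> is that of \<open>R\<close>.
\<close>

lemma logderiv_first_coeff:
  fixes F R :: "int fps"
  assumes F0: "F $ 0 = 1" and RF: "fps_X * fps_deriv F = R * F" and n: "n > 0"
    and low: "\<And>i. 0 < i \<Longrightarrow> i < n \<Longrightarrow> R $ i = 0"
  shows "R $ n = int n * F $ n"
proof -
  have "R $ 0 * F $ 0 = (R * F) $ 0" by simp
  also have "\<dots> = 0" by (simp flip: RF)
  finally have R0: "R $ 0 = 0" using F0 by simp
  have "(R * F) $ n = (\<Sum>i=0..n. R $ i * F $ (n - i))"
    by (simp add: fps_mult_nth)
  also have "\<dots> = (\<Sum>i\<in>{n}. R $ i * F $ (n - i))"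
    proof (rule sum.mono_neutral_right)
    show "\<forall>i\<in>{0..n} - {n}. R $ i * F $ (n - i) = 0"
    proof
      fix i assume "i \<in> {0..n} - {n}"
      then have "R $ i = 0" using R0 low[of i] by (cases "i = 0") auto
      then show "R $ i * F $ (n - i) = 0" by simp
    qed
  qed auto
  finally have "(R * F) $ n = R $ n" using F0 by simp
  moreover have "(fps_X * fps_deriv F) $ n = int n * F $ n"
    using n by simp
  ultimately show ?thesis using RF by simp
qed

text \<open>
  Suppose \<open>d\<close> divides \<open>h d\<close> for all \<open>d < n\<close>. Removing \<open>h d / d\<close> cycles of every length \<open>d < n\<close> from
  \<open>S\<close> cancels all coefficients between \<open>0\<close> and \<open>n\<close>, and leaves \<open>h n\<close> as coefficient at \<open>n\<close>. By the
  previous lemma this is a multiple of \<open>n\<close>.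
\<close>

lemma logderiv_Gauss_congruence:
  fixes F S :: "int fps"
  assumes F0: "F $ 0 = 1" and SF: "fps_X * fps_deriv F = S * F"
    and h: "\<And>n. n > 0 \<Longrightarrow> S $ n = (\<Sum>d | d dvd n. h d)"
    and n: "n > 0"
  shows "int n dvd h n"
  using n
proof (induction n rule: less_induct)
  case (less n)
  define R where "R = S - (\<Sum>d\<in>{1..<n}. of_int (h d div int d) * cycle_series d)"
  obtain G :: "int fps" where G: "G $ 0 = 1" "fps_X * fps_deriv G = R * G"
    using logderiv_remove_cycles[OF F0 SF, of "{1..<n}" "\<lambda>d. h d div int d"]
    by (auto simp: R_def)
  have R: "R $ k = S $ k - (\<Sum>d | d dvd k \<and> d < n. h d)" if "k > 0" for k
  proof -
    have "(\<Sum>d\<in>{1..<n}. of_int (h d div int d) * cycle_series d) $ k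
        = (\<Sum>d\<in>{1..<n}. if d dvd k then h d else 0)"
      unfolding fps_sum_nth
    proof (rule sum.cong[OF refl])
      fix d assume d: "d \<in> {1..<n}"
      then have "h d div int d * int d = h d" using less by auto
      then show "(of_int (h d div int d) * cycle_series d) $ k = (if d dvd k then h d else 0)"
        using that by (simp add: fps_of_int[symmetric] cycle_series_def)
    qed
    also have "\<dots> = (\<Sum>d\<in>{d\<in>{1..<n}. d dvd k}. h d)"
      by (rule sum.inter_filter[symmetric]) simp
    also have "{d\<in>{1..<n}. d dvd k} = {d. d dvd k \<and> d < n}"
      using that by (auto simp: Suc_le_eq intro!: gr0I)
    finally show ?thesis by (simp add: R_def)
  qed
  have "R $ i = 0" if "0 < i" "i < n" for i
  proof -
    have "{d. d dvd i \<and> d < n} = {d. d dvd i}"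
      using that by (auto dest: dvd_imp_le)
    then show ?thesis using R[of i] h[of i] that by simp
  qed
  from logderiv_first_coeff[OF G less.prems this] have "R $ n = int n * G $ n" by simp
  moreover have "R $ n = h n"
  proof -
    have "{d. d dvd n} = insert n {d. d dvd n \<and> d < n}"
      using less.prems by (auto dest: dvd_imp_le)
    then have "(\<Sum>d | d dvd n. h d) = h n + (\<Sum>d | d dvd n \<and> d < n. h d)"
      by simp
    then show ?thesis using R[of n] h[of n] less.prems by simp
  qed
  ultimately show ?case by simp
qed

text \<open>The trace sequence \<open>\<lambda>\<^sup>n + \<mu>\<^sup>n\<close> of the roots of \<open>x\<^sup>2 - a x - b\<close>.\<close>

fun lucas_V :: "int \<Rightarrow> int \<Rightarrow> nat \<Rightarrow> int" where
  "lucas_V a b 0 = 2"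
| "lucas_V a b (Suc 0) = a"
| "lucas_V a b (Suc (Suc n)) = a * lucas_V a b (Suc n) + b * lucas_V a b n"

text \<open>
  With \<open>F = 1 - a X - b X\<^sup>2 = (1 - \<lambda> X) (1 - \<mu> X)\<close>, the logarithmic derivative of \<open>F\<close> has the
  coefficients \<open>- V n\<close> for \<open>n > 0\<close>.
\<close>

lemma lucas_V_Gauss_congruence:
  assumes h: "\<And>n. n > 0 \<Longrightarrow> lucas_V a b n = (\<Sum>d | d dvd n. h d)" and n: "n > 0"
  shows "int n dvd h n"
proof -
  define F :: "int fps" where "F = Abs_fps (\<lambda>n. if n = 0 then 1 else if n = 1 then -a else if n = 2 then -b else 0)"
  define S where "S = Abs_fps (\<lambda>n. if n = 0 then 0 else - lucas_V a b n)"
  have F: "F = 1 - fps_const a * fps_X - fps_const b * fps_X\<^sup>2"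
    by (rule fps_ext) (auto simp: F_def fps_X_power_nth)
  have "fps_X * fps_deriv F = S * F"
  proof (rule fps_ext)
    fix n
    have SF: "(S * F) $ n = S $ n - (if n = 0 then 0 else a * S $ (n - 1))
        - (if n < 2 then 0 else b * S $ (n - 2))"
    proof -
      have "S * F = S - fps_const a * (S * fps_X) - fps_const b * (S * fps_X\<^sup>2)"
        unfolding F by (simp add: algebra_simps)
      then show ?thesis by (simp add: fps_X_power_mult_right_nth)
    qed
    consider "n = 0" | "n = 1" | "n = 2" | m where "n = m + 3"
      by (metis One_nat_def add.commute add_2_eq_Suc' numeral_3_eq_3 add_Suc_right not0_implies_Suc numeral_2_eq_2 add_0)
    then show "(fps_X * fps_deriv F) $ n = (S * F) $ n"
      unfolding SF
      by cases (simp_all add: F_def S_def numeral_2_eq_2 numeral_3_eq_3 algebra_simps)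
  qed
  moreover have "F $ 0 = 1" by (simp add: F_def)
  moreover have "S $ n = (\<Sum>d | d dvd n. - h d)" if "n > 0" for n
    using h[OF that] that by (simp add: S_def sum_negf)
  ultimately have "int n dvd - h n"
    using logderiv_Gauss_congruence[of F S "\<lambda>d. - h d"] n by blast
  then show ?thesis by simp
qed

text \<open>
  The function \<open>h\<close> determined by \<open>x n = (\<Sum>d | d dvd n. h d)\<close>, obtained by solving for the term
  \<open>h n\<close>. For \<open>n = 0\<close>, which has infinitely many divisors, the recursive sum is empty.
\<close>

function moebius_inversion :: "(nat \<Rightarrow> int) \<Rightarrow> nat \<Rightarrow> int" where
  "moebius_inversion x n = x n - (\<Sum>d\<in>{d. d dvd n \<and> d < n}. moebius_inversion x d)"
  by pat_completeness auto
termination by (relation "measure snd") auto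

declare moebius_inversion.simps [simp del]

lemma sum_moebius_inversion:
  assumes "n > 0"
  shows "x n = (\<Sum>d | d dvd n. moebius_inversion x d)"
proof -
  have "{d. d dvd n} = insert n {d. d dvd n \<and> d < n}"
    using assms by (auto dest: dvd_imp_le)
  then show ?thesis by (simp add: moebius_inversion.simps[of x n])
qed

section \<open>Growth of the recurrence sequence\<close>

text \<open>A zero at \<open>n + 2\<close> would make the term at \<open>n + 3\<close> equal to \<open>b x (n + 1) < 0\<close>.\<close>

lemma recurrence_positive:
  fixes x :: "nat \<Rightarrow> int"
  assumes rec: "\<And>n. n \<ge> 1 \<Longrightarrow> x (n + 2) = a * x (n + 1) + b * x n"
    and nonneg: "\<And>n. x n \<ge> 0" and "x 1 > 0" "x 2 > 0" and b: "b < 0"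
    and n: "n \<ge> 1"
  shows "x n > 0"
proof -
  have "x n > 0 \<and> x (Suc n) > 0"
    using n
  proof (induction n rule: dec_induct)
    case base
    then show ?case using assms by (simp add: numeral_2_eq_2)
  next
    case (step n)
    have "x (n + 2) \<noteq> 0"
    proof
      assume "x (n + 2) = 0"
      then have "x (n + 3) = b * x (n + 1)" using rec[of "n + 1"] by (simp add: numeral_3_eq_3)
      also have "\<dots> < 0" using step b by (simp add: mult_less_0_iff)
      finally show False using nonneg[of "n + 3"] by simp
    qed
    then show ?case using step nonneg[of "n + 2"] by simp
  qed
  then show ?thesis by blast
qed

text \<open>
  If \<open>\<Delta> < 0\<close>, the ratios \<open>r n = x (n + 1) / x n\<close> satisfy \<open>r (n + 1) = a + b / r n\<close>, which gives
  \<open>r n - r (n + 1) = ((2 r n - a)\<^sup>2 - \<Delta>) / (4 r n) \<ge> 1 / (4 r n)\<close> because \<open>\<Delta> \<le> -1\<close>. So the ratios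
  decrease at every step by at least \<open>1 / (4 r 1)\<close> and become negative.
\<close>

lemma discriminant_nonneg:
  fixes x :: "nat \<Rightarrow> int"
  assumes rec: "\<And>n. n \<ge> 1 \<Longrightarrow> x (n + 2) = a * x (n + 1) + b * x n"
    and nonneg: "\<And>n. x n \<ge> 0" and "x 1 > 0" "x 2 > 0"
  shows "a\<^sup>2 + 4 * b \<ge> 0"
proof (rule ccontr)
  assume "\<not> ?thesis"
  then have neg: "a\<^sup>2 + 4 * b < 0" by simp
  then have "b < 0" by (smt (verit) zero_le_power2)
  note pos = recurrence_positive[OF rec nonneg assms(3,4) this]
  define r where "r n = real_of_int (x (n + 1)) / real_of_int (x n)" for n
  have r_pos: "r n > 0" if "n \<ge> 1" for n
    using pos[of n] pos[of "n + 1"] that by (simp add: r_def)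
  have r_Suc: "r (n + 1) = a + b / r n" if "n \<ge> 1" for n
    using pos[of n] pos[of "n + 1"] that rec[OF that] by (simp add: r_def field_simps)
  have drop: "r (n + 1) \<le> r n - 1 / (4 * r n)" if "n \<ge> 1" for n
  proof -
    have "real_of_int (a\<^sup>2 + 4 * b) \<le> real_of_int (- 1)"
      using neg by (intro of_int_le_iff[THEN iffD2]) linarith
    then have "real_of_int a ^ 2 + 4 * real_of_int b \<le> -1" by simp
    moreover have "(2 * r n - a)\<^sup>2 \<ge> 0" by simp
    ultimately have "4 * (r n)\<^sup>2 - 4 * a * r n - 4 * b \<ge> 1"
      by (simp add: power2_eq_square algebra_simps)
    then have "r n * (4 * r n - 4 * a) - 4 * b \<ge> 1"
      by (simp add: power2_eq_square algebra_simps)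
    then have "0 \<le> (r n * (4 * r n - 4 * a) - 4 * b - 1) / (4 * r n)"
      using r_pos[OF that] by simp
    also have "\<dots> = r n - 1 / (4 * r n) - r (n + 1)"
      using r_pos[OF that] unfolding r_Suc[OF that] by (simp add: field_simps)
    finally show ?thesis by simp
  qed
  have bound: "r (Suc n) \<le> r 1 - n / (4 * r 1)" for n
  proof (induction n)
    case (Suc n)
    have "r (Suc n) \<le> r 1"
      using Suc r_pos[of 1] by (smt (verit) divide_nonneg_pos le_numeral_extra(4) of_nat_0_le_iff)
    then have "1 / (4 * r 1) \<le> 1 / (4 * r (Suc n))"
      using r_pos[of "Suc n"] by (intro divide_left_mono) auto
    then have "r (Suc (Suc n)) \<le> r (Suc n) - 1 / (4 * r 1)"
      using drop[of "Suc n"] by simp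
    then show ?case using Suc by (simp add: add_divide_distrib)
  qed simp
  obtain n :: nat where "real n > 4 * r 1 * r 1" using reals_Archimedean2 by blast
  then have "r 1 - n / (4 * r 1) < 0" using r_pos[of 1] by (simp add: field_simps)
  then show False using bound[of n] r_pos[of "Suc n"] by simp
qed

lemma superadditive_sum_le:
  fixes x :: "nat \<Rightarrow> int"
  assumes "x 2 \<ge> 0" and "\<And>n. n \<ge> 1 \<Longrightarrow> x (n + 2) \<ge> x (n + 1) + x n"
  shows "(\<Sum>d=1..m. x d) \<le> x (m + 2)"
proof (induction m)
  case (Suc m)
  then show ?case using assms(2)[of "Suc m"] by (simp add: algebra_simps)
qed (use assms in \<open>simp add: numeral_2_eq_2\<close>)

text \<open>
  By induction \<open>h d \<le> x d\<close> for the proper divisors \<open>d\<close> of \<open>n\<close>. For \<open>n \<ge> 3\<close> these lie in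
  \<open>{1..n - 2}\<close>, so the sum of their \<open>x d\<close> is at most \<open>x n\<close> and leaves \<open>h n \<ge> 0\<close>.
\<close>

lemma orbit_count_nonneg:
  fixes x h :: "nat \<Rightarrow> int"
  assumes nonneg: "\<And>n. x n \<ge> 0" and "x 1 \<le> x 2"
    and super: "\<And>n. n \<ge> 1 \<Longrightarrow> x (n + 2) \<ge> x (n + 1) + x n"
    and h: "\<And>n. n \<ge> 1 \<Longrightarrow> x n = (\<Sum>d | d dvd n. h d)"
    and "n \<ge> 1"
  shows "h n \<ge> 0"
  using \<open>n \<ge> 1\<close>
proof (induction n rule: less_induct)
  case (less n)
  define P where "P = {d. d dvd n \<and> d < n}"
  have D: "{d. d dvd n} = insert n P" "n \<notin> P" "finite P"
    using less.prems by (auto simp: P_def dest: dvd_imp_le)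
  have P1: "d \<ge> 1 \<and> d < n" if "d \<in> P" for d
    using that less.prems by (auto simp: P_def intro!: Suc_leI gr0I)
  have "(\<Sum>d\<in>P. h d) \<le> (\<Sum>d\<in>P. x d)"
  proof (rule sum_mono)
    fix d assume "d \<in> P"
    then have d: "d \<ge> 1" "d < n" using P1 by auto
    have "h d \<le> (\<Sum>e | e dvd d. h e)"
    proof (rule member_le_sum)
      fix e assume "e \<in> {e. e dvd d} - {d}"
      then have "e \<ge> 1" "e < n" using d by (auto dest: dvd_imp_le intro!: Suc_leI gr0I)
      then show "h e \<ge> 0" using less.IH by blast
    qed (use d in auto)
    then show "h d \<le> x d" using h[OF d(1)] by simp
  qed
  also have "\<dots> \<le> x n"
  proof -
    consider "n = 1" | "n = 2" | "n \<ge> 3" using less.prems by linarith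
    then show ?thesis
    proof cases
      case 1
      then have "P = {}" using P1 by force
      then show ?thesis using nonneg by simp
    next
      case 2
      then have "P \<subseteq> {1}" using P1 by force
      then have "(\<Sum>d\<in>P. x d) \<le> (\<Sum>d\<in>{1}. x d)" using nonneg by (intro sum_mono2) auto
      then show ?thesis using assms(2) 2 by simp
    next
      case 3
      have "P \<subseteq> {1..n - 2}"
      proof
        fix d assume d: "d \<in> P"
        then obtain k where k: "n = d * k" by (auto simp: P_def)
        have "k \<ge> 2" using P1[OF d] k less.prems by (cases "k = 0 \<or> k = 1") auto
        then have "n \<ge> 2 * d" using k by simp
        then show "d \<in> {1..n - 2}" using P1[OF d] 3 by auto
      qed
      then have "(\<Sum>d\<in>P. x d) \<le> (\<Sum>d=1..n-2. x d)" using nonneg by (intro sum_mono2) auto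
      also have "\<dots> \<le> x (n - 2 + 2)" using superadditive_sum_le[OF nonneg super] by blast
      also have "n - 2 + 2 = n" using 3 by simp
      finally show ?thesis .
    qed
  qed
  finally show ?case using h[OF less.prems] D by simp
qed

text \<open>
  For \<open>b > 0\<close> this is immediate from the recurrence, as \<open>a, b \<ge> 1\<close>. For \<open>b < 0\<close> the condition
  \<open>\<Delta> > 0\<close> forces \<open>a \<ge> 3\<close>; the ratios of consecutive terms stay at least \<open>a / 2\<close>, and then
  \<open>4 (x (n + 2) - x (n + 1) - x n)\<close> is at least \<open>(2 (a - 1) a - 4 + 4 b) x n\<close>, whose coefficient is
  at least \<open>(a - 3) (a + 1)\<close>.
\<close>

lemma trace_sequence_superadditive:
  fixes x :: "nat \<Rightarrow> int"
  assumes rec: "\<And>n. n \<ge> 1 \<Longrightarrow> x (n + 2) = a * x (n + 1) + b * x n"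
    and nonneg: "\<And>n. x n \<ge> 0" and pos: "a > 0" "a\<^sup>2 + 4 * b > 0" and "b \<noteq> 0"
    and x: "x 1 = k * a" "x 2 = k * (a\<^sup>2 + 2 * b)" "k > 0"
  shows "x 1 \<le> x 2" and "n \<ge> 1 \<Longrightarrow> x (n + 2) \<ge> x (n + 1) + x n"
proof -
  have "a \<le> a\<^sup>2 + 2 * b \<and> (\<forall>n\<ge>1. x (n + 2) \<ge> x (n + 1) + x n)"
  proof (cases "b > 0")
    case True
    have "a \<le> a\<^sup>2" using pos by (simp add: power2_eq_square)
    moreover have "x (n + 2) \<ge> x (n + 1) + x n" if "n \<ge> 1" for n
    proof -
      have "1 * x (n + 1) \<le> a * x (n + 1)" "1 * x n \<le> b * x n"
        using True pos nonneg by (intro mult_right_mono; simp)+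
      then show ?thesis using rec[OF that] by simp
    qed
    ultimately show ?thesis using True by auto
  next
    case False
    then have b: "b \<le> -1" using \<open>b \<noteq> 0\<close> by simp
    have "a \<ge> 3"
    proof (rule ccontr)
      assume "\<not> a \<ge> 3"
      then have "a = 1 \<or> a = 2" using pos by linarith
      then show False using pos b by auto
    qed
    have growth: "a * x n \<le> 2 * x (n + 1)" if "n \<ge> 1" for n
      using that
    proof (induction n rule: dec_induct)
      case base
      have "2 * x 2 - a * x 1 = k * (a\<^sup>2 + 4 * b)" using x by (simp add: algebra_simps power2_eq_square)
      also have "\<dots> \<ge> 0" using x pos by simp
      finally show ?case by (simp add: numeral_2_eq_2)
    next
      case (step n)
      have "2 * (a * x (n + 1)) \<ge> a\<^sup>2 * x n"
        using mult_left_mono[OF step.IH, of a] pos by (simp add: power2_eq_square algebra_simps)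
      moreover have "(a\<^sup>2 + 4 * b) * x n \<ge> 0" using pos nonneg by simp
      ultimately have "a * x (n + 1) + 2 * b * x n \<ge> 0" by (simp add: algebra_simps)
      then show ?case using rec[OF step.hyps(1)] by simp
    qed
    have quad: "(a - 3) * (a + 1) \<ge> 0" using \<open>a \<ge> 3\<close> by simp
    have "x (n + 2) \<ge> x (n + 1) + x n" if "n \<ge> 1" for n
    proof -
      have "(a - 1) * (2 * x (n + 1)) \<ge> (a - 1) * (a * x n)"
        using growth[OF that] \<open>a \<ge> 3\<close> by (intro mult_left_mono) auto
      moreover have "(2 * (a - 1) * a - 4 + 4 * b) * x n \<ge> 0"
      proof (rule mult_nonneg_nonneg)
        show "0 \<le> 2 * (a - 1) * a - 4 + 4 * b"
          using quad pos(2) by (simp add: power2_eq_square algebra_simps)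
      qed (rule nonneg)
      ultimately have "4 * ((a - 1) * x (n + 1)) \<ge> 4 * ((1 - b) * x n)"
        by (simp add: algebra_simps)
      then show ?thesis using rec[OF that] by (simp add: algebra_simps)
    qed
    moreover have "a \<le> a\<^sup>2 + 2 * b"
      using pos(2) zero_le_power2[of "a - 1"] by (simp add: power2_eq_square algebra_simps)
    ultimately show ?thesis by blast
  qed
  then show "x 1 \<le> x 2" and "n \<ge> 1 \<Longrightarrow> x (n + 2) \<ge> x (n + 1) + x n"
    using x by auto
qed

section \<open>Sufficiency of the ratio condition\<close>

lemma ER_of_trace_multiple:
  fixes u :: "nat \<Rightarrow> nat"
  assumes rec: "\<And>n. n \<ge> 1 \<Longrightarrow> int (u (n + 2)) = a * int (u (n + 1)) + b * int (u n)"
    and pos: "a > 0" "a\<^sup>2 + 4 * b > 0" and "b \<noteq> 0"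
    and u: "int (u 1) = k * a" "int (u 2) = k * (a\<^sup>2 + 2 * b)" "k > 0"
  shows "u \<in> ER"
proof -
  define h where "h = moebius_inversion (lucas_V a b)"
  have uV: "int (u (Suc n)) = k * lucas_V a b (Suc n)" for n
  proof (induction n rule: less_induct)
    case (less n)
    consider "n = 0" | "n = 1" | m where "n = Suc (Suc m)" by (metis One_nat_def not0_implies_Suc)
    then show ?case
    proof cases
      case 3
      then show ?thesis using rec[of "Suc m"] less.IH[of m] less.IH[of "Suc m"]
        by (simp add: algebra_simps)
    qed (use u in \<open>simp_all add: numeral_2_eq_2 power2_eq_square algebra_simps\<close>)
  qed
  have sum: "int (u n) = (\<Sum>d | d dvd n. k * h d)" if "n \<ge> 1" for n
    using uV[of "n - 1"] sum_moebius_inversion[of n "lucas_V a b"] that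
    by (simp add: h_def sum_distrib_left)
  have nn: "k * h n \<ge> 0" if "n \<ge> 1" for n
    by (rule orbit_count_nonneg[of "\<lambda>n. int (u n)" "\<lambda>n. k * h n"])
      (use trace_sequence_superadditive[of "\<lambda>n. int (u n)", OF rec _ pos \<open>b \<noteq> 0\<close> u] sum that in auto)
  have div: "int n dvd h n" if "n \<ge> 1" for n
    using lucas_V_Gauss_congruence[of a b h n] sum_moebius_inversion[of _ "lucas_V a b"] that
    by (simp add: h_def)
  define c where "c n = nat (k * h n div int n)" for n
  have c: "int (n * c n) = k * h n" if "n \<ge> 1" for n
  proof -
    have "int n dvd k * h n" using div[OF that] by simp
    moreover have "k * h n div int n \<ge> 0" using nn[OF that] that by (simp add: pos_imp_zdiv_nonneg_iff)
    ultimately show ?thesis by (simp add: c_def)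
  qed
  show ?thesis
  proof (rule ER_of_cycle_counts[of _ c])
    fix n :: nat assume n: "n \<ge> 1"
    have "int (u n) = (\<Sum>d | d dvd n. int (d * c d))"
      unfolding sum[OF n] by (rule sum.cong) (use n c in \<open>auto intro!: Suc_leI gr0I simp flip: c\<close>)
    then show "u n = (\<Sum>d | d dvd n. d * c d)"
      by (simp flip: of_nat_sum of_nat_mult)
  qed
qed

section \<open>Primes modulo which a non-square is a non-residue\<close>

lemma Legendre_values: "Legendre a p \<in> {-1, 0, 1}"
  by (simp add: Legendre_def)

text \<open>Used to pass from Euler's criterion, a congruence, to equalities of Legendre symbols.\<close>

lemma sign_eq_of_cong:
  fixes x y :: int
  assumes "[x = y] (mod int p)" "p > 2" "x \<in> {-1, 0, 1}" "y \<in> {-1, 0, 1}"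
  shows "x = y"
proof (rule ccontr)
  assume "x \<noteq> y"
  have "int p dvd x - y" using assms(1) by (simp add: cong_iff_dvd_diff)
  then have "int p \<le> \<bar>x - y\<bar>" using \<open>x \<noteq> y\<close> dvd_imp_le_int[of "x - y" "int p"] by simp
  moreover have "\<bar>x - y\<bar> \<le> 2" using assms(3,4) by auto
  ultimately show False using assms(2) by simp
qed

lemma Legendre_mult:
  assumes "prime p" "p > 2"
  shows "Legendre (a * b) (int p) = Legendre a (int p) * Legendre b (int p)"
proof -
  have E: "[Legendre x (int p) = x ^ ((p - 1) div 2)] (mod int p)" for x
    using euler_criterion[OF assms] .
  have "[Legendre (a * b) (int p) = Legendre a (int p) * Legendre b (int p)] (mod int p)"
    using cong_trans[OF E[of "a * b"]] cong_sym[OF cong_mult[OF E[of a] E[of b]]]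
    by (simp add: power_mult_distrib)
  moreover have "Legendre a (int p) * Legendre b (int p) \<in> {-1, 0, 1}"
    using Legendre_values[of a "int p"] Legendre_values[of b "int p"] by auto
  ultimately show ?thesis
    using assms(2) Legendre_values sign_eq_of_cong by blast
qed

lemma Legendre_cong:
  "[a = b] (mod p) \<Longrightarrow> Legendre a p = Legendre b p"
  by (simp add: Legendre_def QuadRes_def cong_def)

lemma Legendre_1: "prime p \<Longrightarrow> Legendre 1 (int p) = 1"
proof -
  assume "prime p"
  then have "\<not> [1 = 0] (mod int p)"
    using prime_gt_1_nat[of p] by (simp add: cong_0_iff)
  moreover have "QuadRes (int p) 1"
    unfolding QuadRes_def by (rule exI[of _ 1]) simp
  ultimately show ?thesis by (simp add: Legendre_def)
qed

lemma Legendre_prod_mset: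
  assumes "prime p" "p > 2"
  shows "Legendre (int (prod_mset M)) (int p) = (\<Prod>q\<in>#M. Legendre (int q) (int p))"
  by (induction M) (simp_all add: Legendre_1 Legendre_mult assms)

text \<open>
  For odd \<open>n\<close> this is the non-trivial Dirichlet character modulo \<open>4\<close>. The exponent is written as
  in the law of quadratic reciprocity.
\<close>

definition sign4 :: "nat \<Rightarrow> int" where
  "sign4 n = (-1) ^ ((n - 1) div 2)"

lemma sign4_eq: "odd n \<Longrightarrow> sign4 n = (if n mod 4 = 1 then 1 else -1)"
proof -
  assume "odd n"
  then obtain k where k: "n = 2 * k + 1" by (elim oddE)
  show ?thesis
  proof (cases "even k")
    case True
    then have "n mod 4 = 1" unfolding k by presburger
    then show ?thesis using True by (simp add: sign4_def k)
  next
    case False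
    then have "n mod 4 \<noteq> 1" unfolding k by presburger
    then show ?thesis using False by (simp add: sign4_def k)
  qed
qed

lemma sign4_mult: "odd m \<Longrightarrow> odd n \<Longrightarrow> sign4 (m * n) = sign4 m * sign4 n"
proof -
  assume *: "odd m" "odd n"
  then have "m mod 4 = 1 \<or> m mod 4 = 3" "n mod 4 = 1 \<or> n mod 4 = 3" by presburger+
  then have "(m * n) mod 4 = 1 \<longleftrightarrow> (m mod 4 = 1 \<longleftrightarrow> n mod 4 = 1)"
    by (subst mod_mult_eq[symmetric]) auto
  then show ?thesis using * by (simp add: sign4_eq)
qed

lemma sign4_prod_mset:
  assumes "\<And>q. q \<in># M \<Longrightarrow> odd q"
  shows "odd (prod_mset M) \<and> sign4 (prod_mset M) = (\<Prod>q\<in>#M. sign4 q)"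
  using assms
proof (induction M)
  case empty
  then show ?case by (simp add: sign4_def)
next
  case (add x M)
  then show ?case by (simp add: sign4_mult)
qed

lemma prime_factor_3_mod_4:
  assumes "n mod 4 = (3::nat)"
  shows "\<exists>p. prime p \<and> p dvd n \<and> p mod 4 = 3"
proof (rule ccontr)
  assume no: "\<not> ?thesis"
  have "n \<noteq> 0" "odd n" using assms by presburger+
  have oddq: "odd q" if "q \<in># prime_factorization n" for q
    using that \<open>odd n\<close> by (auto simp: in_prime_factors_iff)
  have "q mod 4 = 1" if "q \<in># prime_factorization n" for q
  proof -
    have "q mod 4 \<noteq> 3" using no that by (auto simp: in_prime_factors_iff)
    then show ?thesis using oddq[OF that] by presburger
  qed
  then have "sign4 q = 1" if "q \<in># prime_factorization n" for q
    using that oddq by (simp add: sign4_eq)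
  then have "(\<Prod>q\<in>#prime_factorization n. sign4 q) = 1"
    by (intro prod_mset.neutral) auto
  then have "sign4 n = 1"
    using sign4_prod_mset[OF oddq, of "prime_factorization n"] \<open>n \<noteq> 0\<close>
    by (simp add: prod_mset_prime_factorization_nat)
  then show False using assms \<open>odd n\<close> by (simp add: sign4_eq)
qed

lemma Legendre_minus_one:
  assumes "prime p" "p mod 4 = 3"
  shows "Legendre (-1) (int p) = -1"
proof -
  have "p > 2" using assms prime_gt_1_nat[of p] by (cases "p = 2") auto
  obtain k where "p = 4 * k + 3" using assms(2) by (metis mult_div_mod_eq)
  then have "odd ((p - 1) div 2)" by simp
  then have "[Legendre (-1) (int p) = -1] (mod int p)"
    using euler_criterion[OF assms(1) \<open>p > 2\<close>, of "-1"] by simp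
  then show ?thesis
    using \<open>p > 2\<close> Legendre_values sign_eq_of_cong by blast
qed

text \<open>
  Both sides are Jacobi symbols, written out as products of Legendre symbols over prime
  factorizations. Each expands to a product over pairs of primes \<open>q\<close> dividing \<open>m\<close> and \<open>p\<close> dividing
  \<open>n\<close>. Exchanging \<open>p\<close> and \<open>q\<close> costs the sign \<open>sign4 q ^ ((p - 1) div 2)\<close>, and for a fixed \<open>p\<close> these
  signs multiply to a power of \<open>sign4 m = 1\<close>.
\<close>

lemma Jacobi_reciprocity:
  fixes m n :: nat
  assumes m: "m mod 4 = 1" and n: "odd n" and cop: "coprime m n"
  shows "(\<Prod>p\<in>#prime_factorization n. Legendre (int m) (int p)) =
         (\<Prod>q\<in>#prime_factorization m. Legendre (int n) (int q))"
proof -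
  let ?M = "prime_factorization m" and ?N = "prime_factorization n"
  have "odd m" using m by presburger
  then have nz: "m \<noteq> 0" "n \<noteq> 0" using n odd_pos by auto
  have gt2: "r > 2 \<and> odd r \<and> prime r" if "r \<in># ?M \<or> r \<in># ?N" for r
  proof -
    have r: "prime r" "odd r" using that \<open>odd m\<close> n by (auto simp: in_prime_factors_iff)
    then have "r \<noteq> 2" by auto
    then show ?thesis using r prime_gt_1_nat[of r] by auto
  qed
  have mM: "prod_mset ?M = m" and nN: "prod_mset ?N = n"
    using nz by (simp_all add: prod_mset_prime_factorization_nat)
  have power: "(\<Prod>q\<in>#M. sign4 q ^ k) = (\<Prod>q\<in>#M. sign4 q) ^ k" for M k
    by (induction M) (simp_all add: power_mult_distrib)
  have QR: "Legendre (int q) (int p) = sign4 q ^ ((p - 1) div 2) * Legendre (int p) (int q)"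
    if "q \<in># ?M" "p \<in># ?N" for p q
  proof -
    have "p \<noteq> q"
    proof
      assume "p = q"
      then have "p dvd m" "p dvd n" "prime p" using that by (auto simp: in_prime_factors_iff)
      then show False using cop by (meson coprime_common_divisor not_prime_unit)
    qed
    then have "Legendre (int p) (int q) * Legendre (int q) (int p) = (-1) ^ ((p - 1) div 2 * ((q - 1) div 2))"
      using Quadratic_Reciprocity gt2 that by metis
    also have "\<dots> = sign4 q ^ ((p - 1) div 2)"
      by (simp add: sign4_def power_mult[symmetric] mult.commute)
    finally have eq: "Legendre (int p) (int q) * Legendre (int q) (int p) = sign4 q ^ ((p - 1) div 2)" .
    have "sign4 q ^ ((p - 1) div 2) \<noteq> 0" by (simp add: sign4_def)
    with eq have "Legendre (int p) (int q) \<noteq> 0" by auto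
    then have "Legendre (int p) (int q) * Legendre (int p) (int q) = 1"
      using Legendre_values[of "int p" "int q"] by auto
    then show ?thesis unfolding eq[symmetric] by (simp add: mult_ac)
  qed
  have "(\<Prod>p\<in>#?N. Legendre (int m) (int p)) = (\<Prod>p\<in>#?N. \<Prod>q\<in>#?M. Legendre (int p) (int q))"
  proof (intro arg_cong[of _ _ prod_mset] image_mset_cong)
    fix p assume p: "p \<in># ?N"
    have "Legendre (int m) (int p) = (\<Prod>q\<in>#?M. Legendre (int q) (int p))"
      using Legendre_prod_mset[of p ?M] gt2 p mM by auto
    also have "\<dots> = (\<Prod>q\<in>#?M. sign4 q ^ ((p - 1) div 2) * Legendre (int p) (int q))"
      using QR p by (intro arg_cong[of _ _ prod_mset] image_mset_cong) auto
    also have "\<dots> = (\<Prod>q\<in>#?M. sign4 q) ^ ((p - 1) div 2) * (\<Prod>q\<in>#?M. Legendre (int p) (int q))"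
      by (simp add: prod_mset.distrib power)
    also have "(\<Prod>q\<in>#?M. sign4 q) = 1"
      using sign4_prod_mset[of ?M] gt2 mM m \<open>odd m\<close> by (auto simp: sign4_eq)
    finally show "Legendre (int m) (int p) = (\<Prod>q\<in>#?M. Legendre (int p) (int q))" by simp
  qed
  also have "\<dots> = (\<Prod>q\<in>#?M. \<Prod>p\<in>#?N. Legendre (int p) (int q))"
    by (rule prod_mset.swap)
  also have "\<dots> = (\<Prod>q\<in>#?M. Legendre (int n) (int q))"
  proof (intro arg_cong[of _ _ prod_mset] image_mset_cong)
    fix q assume "q \<in># ?M"
    then show "(\<Prod>p\<in>#?N. Legendre (int p) (int q)) = Legendre (int n) (int q)"
      using Legendre_prod_mset[of q ?N] gt2 nN by auto
  qed
  finally show ?thesis .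
qed

text \<open>
  The squares of \<open>z\<close> and \<open>q - z\<close> agree modulo \<open>q\<close>, so there are at most \<open>(q - 1) / 2\<close> non-zero
  squares.
\<close>

lemma exists_nonresidue:
  assumes "prime (q::nat)" "q > 2"
  shows "\<exists>r::nat. Legendre (int r) (int q) = -1"
proof (rule ccontr)
  assume no: "\<not> ?thesis"
  have "{1..q-1} \<subseteq> (\<lambda>y. y^2 mod q) ` {1..(q - 1) div 2}"
  proof
    fix r assume r: "r \<in> {1..q-1}"
    then have "Legendre (int r) (int q) \<noteq> 0"
      using assms(2) by (auto simp: Legendre_def cong_0_iff dest!: dvd_imp_le)
    then have "QuadRes (int q) (int r)"
      using no by (auto simp: Legendre_def split: if_splits)
    then obtain y where y: "[y^2 = int r] (mod int q)" by (auto simp: QuadRes_def)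
    define z where "z = nat (y mod int q)"
    have z: "int z = y mod int q" using assms(2) by (simp add: z_def)
    have zq: "z < q" using assms(2) by (simp add: z_def nat_less_iff)
    have "[int z ^ 2 = int r] (mod int q)"
      using y unfolding z by (simp add: cong_def power_mod)
    then have zr: "[z ^ 2 = r] (mod q)" by (simp flip: cong_int_iff)
    have "z > 0"
      using zr r by (auto simp: cong_def intro: gr0I)
    obtain k where k: "q = 2 * k + 1"
      using assms prime_odd_nat[of q] by (auto elim: oddE)
    show "r \<in> (\<lambda>y. y^2 mod q) ` {1..(q - 1) div 2}"
    proof (cases "z \<le> k")
      case True
      then show ?thesis using zr r k \<open>z > 0\<close> by (auto simp: cong_def intro!: image_eqI[of _ _ z])
    next
      case False
      have "[(int q - int z)^2 = (- int z)^2] (mod int q)"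
        by (intro cong_pow) (simp add: cong_iff_dvd_diff)
      then have "[int (q - z) ^ 2 = int r] (mod int q)"
        using \<open>[int z ^ 2 = int r] (mod int q)\<close> zq by (simp add: of_nat_diff) (rule cong_trans)
      then have "[(q - z)^2 = r] (mod q)" by (simp flip: cong_int_iff)
      then show ?thesis using r k zq False by (auto simp: cong_def intro!: image_eqI[of _ _ "q - z"])
    qed
  qed
  then have "card {1..q-1} \<le> card {1..(q-1) div 2}"
    by (meson card_image_le card_mono finite_atLeastAtMost finite_imageI le_trans)
  then show False using assms(2) by simp
qed

text \<open>
  Some prime \<open>q\<close> divides \<open>m\<close> to an odd power. By the Chinese remainder theorem there is an odd \<open>n\<close>
  that is a non-residue modulo \<open>q\<close> and congruent to \<open>1\<close> modulo all other prime factors of \<open>m\<close>. The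
  Jacobi symbol of \<open>n\<close> over \<open>m\<close> is then \<open>-1\<close>, and by reciprocity so is that of \<open>m\<close> over \<open>n\<close>.
  Hence one of the primes dividing \<open>n\<close> has the required property.
\<close>

lemma exists_inert_prime_1_mod_4:
  fixes m :: nat
  assumes m: "m mod 4 = 1" and ns: "\<nexists>k. m = k\<^sup>2"
  shows "\<exists>p. prime p \<and> p > 2 \<and> Legendre (int m) (int p) = -1"
proof -
  have "odd m" using m by presburger
  then have "m \<noteq> 0" using odd_pos by auto
  have "\<not> is_nth_power 2 m" using ns by (auto simp: is_nth_power_def)
  then obtain q where q: "prime q" "odd (multiplicity q m)"
    by (auto simp: is_nth_power_conv_multiplicity_nat)
  have "q dvd m"
    using q(2) by (metis even_zero not_dvd_imp_multiplicity_0)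
  with \<open>odd m\<close> have "q \<noteq> 2" by auto
  then have "q > 2" using prime_gt_1_nat[OF q(1)] by simp
  obtain r where r: "Legendre (int r) (int q) = -1"
    using exists_nonresidue[OF q(1) \<open>q > 2\<close>] by blast
  obtain l where l: "m = q ^ multiplicity q m * l" "\<not> q dvd l"
    using multiplicity_decompose'[of m q] \<open>m \<noteq> 0\<close> q(1) by (metis not_prime_unit)
  have "coprime q l" using q(1) l(2) by (simp add: prime_imp_coprime)
  then obtain x where x: "[x = r] (mod q)" "[x = 1] (mod l)"
    using binary_chinese_remainder_nat by blast
  \<comment> \<open>As \<open>m\<close> is odd, adding it corrects the parity without changing residues modulo \<open>m\<close>.\<close>
  define n where "n = (if odd x then x else x + m)"
  have "odd n" using \<open>odd m\<close> by (simp add: n_def)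
  have "[n = x] (mod m)" by (simp add: n_def cong_def)
  moreover have "l dvd m" using l(1) by (metis dvd_triv_right)
  ultimately have n: "[n = r] (mod q)" "[n = 1] (mod l)"
    using x \<open>q dvd m\<close> by (meson cong_dvd_modulus_nat cong_trans)+
  let ?M = "prime_factorization m"
  have Leg: "Legendre (int n) (int s) = (if s = q then -1 else 1)" if "s \<in># ?M" for s
  proof (cases "s = q")
    case True
    have "[int n = int r] (mod int q)" using n(1) by (simp add: cong_int_iff)
    then show ?thesis using True r Legendre_cong by simp
  next
    case False
    have s: "prime s" "s dvd m" using that by (auto simp: in_prime_factors_iff)
    have "\<not> s dvd q" using False s(1) q(1) primes_dvd_imp_eq by blast
    then have "\<not> s dvd q ^ multiplicity q m" using s(1) prime_dvd_power by blast
    then have "s dvd l" using s l(1) by (metis prime_dvd_mult_nat)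
    then have "[int n = int 1] (mod int s)"
      using n(2) by (meson cong_dvd_modulus_nat cong_int_iff)
    then show ?thesis using False Legendre_cong Legendre_1[OF s(1)] by simp
  qed
  have "coprime m n"
  proof (rule ccontr)
    assume "\<not> coprime m n"
    then obtain s where s: "prime s" "s dvd m" "s dvd n"
      by (metis coprime_iff_gcd_eq_1 gcd_greatest_iff prime_factor_nat)
    then have "s \<in># ?M" using \<open>m \<noteq> 0\<close> by (auto simp: in_prime_factors_iff)
    moreover have "Legendre (int n) (int s) = 0"
      using s(3) by (simp add: Legendre_def cong_0_iff)
    ultimately show False using Leg[of s] by (auto split: if_splits)
  qed
  have sign: "(\<Prod>s\<in>#M. if s = q then -1 else 1 :: int) = (-1) ^ count M q" for M
    by (induction M) auto
  have "(\<Prod>s\<in>#?M. Legendre (int n) (int s)) = (\<Prod>s\<in>#?M. if s = q then -1 else 1)"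
    by (intro arg_cong[of _ _ prod_mset] image_mset_cong) (use Leg in auto)
  also have "\<dots> = -1"
    using sign[of ?M] q by (simp add: count_prime_factorization_prime)
  finally have prod: "(\<Prod>p\<in>#prime_factorization n. Legendre (int m) (int p)) = -1"
    using Jacobi_reciprocity[OF m \<open>odd n\<close> \<open>coprime m n\<close>] by simp
  have "\<exists>p. p \<in># prime_factorization n \<and> Legendre (int m) (int p) = -1"
  proof (rule ccontr)
    assume "\<not> ?thesis"
    then have nn: "Legendre (int m) (int p) \<ge> 0" if "p \<in># prime_factorization n" for p
      using that Legendre_values[of "int m" "int p"] by auto
    have "(\<Prod>p\<in>#M. f p) \<ge> 0" if "\<And>p. p \<in># M \<Longrightarrow> f p \<ge> 0"
      for M and f :: "nat \<Rightarrow> int"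
      using that by (induction M) auto
    from this[OF nn] have "(\<Prod>p\<in>#prime_factorization n. Legendre (int m) (int p)) \<ge> 0" .
    then show False using prod by simp
  qed
  then obtain p where p: "prime p" "p dvd n" "Legendre (int m) (int p) = -1"
    by (auto simp: in_prime_factors_iff)
  then have "p \<noteq> 2" using \<open>odd n\<close> by auto
  then show ?thesis using p prime_gt_1_nat[OF p(1)] by (intro exI[of _ p]) auto
qed

lemma Legendre_4_mult:
  assumes "prime p" "p > 2"
  shows "Legendre (4 * x) (int p) = Legendre x (int p)"
proof -
  have "\<not> int p dvd int 2" using assms by (auto simp only: int_dvd_int_iff dest: dvd_imp_le)
  then have "Legendre 2 (int p) \<noteq> 0" by (simp add: Legendre_def cong_0_iff)
  then have "Legendre 2 (int p) * Legendre 2 (int p) = 1"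
    using Legendre_values[of 2 "int p"] by auto
  moreover have "Legendre (4 * x) (int p) = Legendre 2 (int p) * Legendre 2 (int p) * Legendre x (int p)"
    using Legendre_mult[OF assms, of 2 "2 * x"] Legendre_mult[OF assms, of 2 x] by simp
  ultimately show ?thesis by simp
qed

text \<open>
  Factors of \<open>4\<close> are squares and can be removed. If \<open>m\<close> is \<open>2\<close> or \<open>3\<close> modulo \<open>4\<close>, then \<open>m + 1\<close> or
  \<open>m + 4\<close> is \<open>3\<close> modulo \<open>4\<close> and has a prime factor \<open>p\<close> that is \<open>3\<close> modulo \<open>4\<close>. Modulo \<open>p\<close>, the
  number \<open>m\<close> is \<open>-1\<close> or \<open>-4\<close>, a non-residue. Only the case of \<open>1\<close> modulo \<open>4\<close> needs reciprocity.
\<close>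

lemma exists_inert_prime_nat:
  fixes m :: nat
  assumes "\<nexists>k. m = k\<^sup>2"
  shows "\<exists>p. prime p \<and> p > 2 \<and> Legendre (int m) (int p) = -1"
  using assms
proof (induction m rule: less_induct)
  case (less m)
  consider "m mod 4 = 0" | "m mod 4 = 1" | "m mod 4 = 2" | "m mod 4 = 3" by linarith
  then show ?case
  proof cases
    case 1
    then obtain l where l: "m = 4 * l" by (auto simp: mod_eq_0_iff_dvd)
    have "l \<noteq> 0" using less.prems l by (intro notI) (simp add: exI[of _ "0::nat"])
    moreover have "\<nexists>k. l = k\<^sup>2"
    proof
      assume "\<exists>k. l = k\<^sup>2"
      then obtain k where "l = k\<^sup>2" by blast
      then have "m = (2 * k)\<^sup>2" using l by (simp add: power_mult_distrib)
      then show False using less.prems by blast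
    qed
    ultimately obtain p where "prime p" "p > 2" "Legendre (int l) (int p) = -1"
      using less.IH[of l] l by auto
    then show ?thesis using Legendre_4_mult[of p "int l"] l by auto
  next
    case 2
    then show ?thesis using exists_inert_prime_1_mod_4 less.prems by blast
  next
    case 3
    then have "(m + 1) mod 4 = 3" by presburger
    then obtain p where p: "prime p" "p dvd m + 1" "p mod 4 = 3"
      using prime_factor_3_mod_4 by blast
    have "int p dvd int (m + 1)" using p(2) by (simp only: int_dvd_int_iff)
    then have "[int m = -1] (mod int p)"
      by (simp add: cong_iff_dvd_diff add.commute)
    then have "Legendre (int m) (int p) = -1"
      using Legendre_cong[of "int m" "-1" "int p"] Legendre_minus_one[OF p(1,3)] by simp
    moreover have "p > 2" using p prime_gt_1_nat[of p] by (cases "p = 2") auto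
    ultimately show ?thesis using p(1) by blast
  next
    case 4
    then have "(m + 4) mod 4 = 3" by simp
    then obtain p where p: "prime p" "p dvd m + 4" "p mod 4 = 3"
      using prime_factor_3_mod_4 by blast
    have p2: "p > 2" using p prime_gt_1_nat[of p] by (cases "p = 2") auto
    have "int p dvd int (m + 4)" using p(2) by (simp only: int_dvd_int_iff)
    then have "[int m = 4 * (-1)] (mod int p)"
      by (simp add: cong_iff_dvd_diff add.commute)
    then have "Legendre (int m) (int p) = -1"
      using Legendre_cong[of "int m" "4 * (-1)" "int p"] Legendre_minus_one[OF p(1,3)]
        Legendre_4_mult[OF p(1) p2, of "-1"] by simp
    then show ?thesis using p(1) p2 by blast
  qed
qed

section \<open>The recurrence at inert primes\<close>

text \<open>
  The binomial theorem for operators, in terms of values only. If \<open>E\<close> and \<open>N\<close> are commuting linear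
  operators with \<open>E = a + N\<close>, then \<open>f n k = E\<^sup>n N\<^sup>k w\<close> satisfies the assumption, and the conclusion
  is the expansion of \<open>(a + N)\<^sup>n N\<^sup>k w\<close>.
\<close>

lemma umbral_binomial:
  fixes f :: "nat \<Rightarrow> nat \<Rightarrow> int"
  assumes f: "\<And>n k. f (Suc n) k = a * f n k + f n (Suc k)"
  shows "f n k = (\<Sum>i\<le>n. of_nat (n choose i) * a ^ (n - i) * f 0 (k + i))"
proof (induction n arbitrary: k)
  case (Suc n)
  let ?t = "\<lambda>c i. of_nat c * a ^ (Suc n - i) * f 0 (k + i)"
  have "a * f n k = (\<Sum>i\<le>n. ?t (n choose i) i)"
    unfolding Suc.IH[of k] sum_distrib_left by (rule sum.cong) (auto simp: Suc_diff_le)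
  also have "\<dots> = (\<Sum>i\<le>Suc n. ?t (n choose i) i)" by simp
  also have "\<dots> = a ^ Suc n * f 0 k + (\<Sum>i\<le>n. ?t (n choose Suc i) (Suc i))"
    by (simp only: sum.atMost_Suc_shift) simp
  finally have 1: "a * f n k = a ^ Suc n * f 0 k + (\<Sum>i\<le>n. ?t (n choose Suc i) (Suc i))" .
  have 2: "f n (Suc k) = (\<Sum>i\<le>n. ?t (n choose i) (Suc i))"
    unfolding Suc.IH[of "Suc k"] by simp
  have "(\<Sum>i\<le>Suc n. ?t (Suc n choose i) i)
      = a ^ Suc n * f 0 k + (\<Sum>i\<le>n. ?t ((n choose i) + (n choose Suc i)) (Suc i))"
    by (simp only: sum.atMost_Suc_shift binomial_Suc_Suc of_nat_add) simp
  also have "\<dots> = a ^ Suc n * f 0 k +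
      ((\<Sum>i\<le>n. ?t (n choose i) (Suc i)) + (\<Sum>i\<le>n. ?t (n choose Suc i) (Suc i)))"
    by (simp add: sum.distrib[symmetric] algebra_simps)
  finally show ?case unfolding f[of n k] 1 2 by simp
qed simp

text \<open>The inner binomial coefficients are divisible by \<open>p\<close>: \<open>(a + N)\<^sup>p \<equiv> a\<^sup>p + N\<^sup>p\<close>.\<close>

lemma umbral_Frobenius:
  fixes f :: "nat \<Rightarrow> nat \<Rightarrow> int"
  assumes f: "\<And>n k. f (Suc n) k = a * f n k + f n (Suc k)" and p: "prime p"
  shows "[f p 0 = a ^ p * f 0 0 + f 0 p] (mod int p)"
proof -
  let ?g = "\<lambda>i. of_nat (p choose i) * a ^ (p - i) * f 0 i"
  have "p > 0" using prime_gt_0_nat[OF p] .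
  then have set: "{..p} = insert 0 (insert p {0<..<p})" by auto
  have "f p 0 = (\<Sum>i\<le>p. ?g i)"
    using umbral_binomial[of f a p 0] f by simp
  also have "\<dots> = a ^ p * f 0 0 + f 0 p + (\<Sum>i\<in>{0<..<p}. ?g i)"
    unfolding set using \<open>p > 0\<close> by simp
  finally have "f p 0 - (a ^ p * f 0 0 + f 0 p) = (\<Sum>i\<in>{0<..<p}. ?g i)" by simp
  moreover have "int p dvd (\<Sum>i\<in>{0<..<p}. ?g i)"
  proof (rule dvd_sum)
    fix i assume "i \<in> {0<..<p}"
    then have "p dvd (p choose i)" using dvd_choose_prime[of i p] p by auto
    then have "int p dvd int (p choose i)" by (simp only: int_dvd_int_iff)
    then show "int p dvd ?g i" by (metis dvd_mult2)
  qed
  ultimately show ?thesis by (simp add: cong_iff_dvd_diff)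
qed

lemma power_prime_cong_self:
  assumes "prime p" "p > 2"
  shows "[x ^ p = x] (mod int p)"
proof -
  define j where "j = (p - 1) div 2"
  have "odd p" using assms prime_odd_nat by auto
  then have "p = j + j + 1" by (auto simp: j_def elim: oddE)
  then have "x ^ p = x ^ j * x ^ j * x" by (metis power_add power_one_right)
  moreover have "[x ^ j * x ^ j * x = Legendre x (int p) * Legendre x (int p) * x] (mod int p)"
    unfolding j_def by (intro cong_mult cong_sym[OF euler_criterion[OF assms]] cong_refl)
  moreover have "[Legendre x (int p) * Legendre x (int p) * x = x] (mod int p)"
    by (auto simp: Legendre_def cong_sym)
  ultimately show ?thesis by (metis cong_trans)
qed

text \<open>
  Let \<open>E\<close> be the shift operator. On solutions of the recurrence \<open>E\<^sup>2 = a E + b\<close>, so \<open>N = 2 E - a\<close>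
  satisfies \<open>N\<^sup>2 = \<Delta>\<close>, and \<open>N\<^sup>p = \<Delta>\<^sup>j N\<close> with \<open>j = (p - 1) / 2\<close>. Modulo \<open>p\<close>, Euler's
  criterion gives \<open>\<Delta>\<^sup>j \<equiv> -1\<close>, so
  \<open>2 E\<^sup>p \<equiv> (a + N)\<^sup>p \<equiv> a + N\<^sup>p \<equiv> a - N = 2 (a - E)\<close>.
  As \<open>a - \<lambda> = \<mu>\<close>, this is the statement that Frobenius exchanges the two roots.
\<close>

lemma recurrence_at_inert_prime:
  fixes w :: "nat \<Rightarrow> int"
  assumes w: "\<And>n. w (n + 2) = a * w (n + 1) + b * w n"
    and p: "prime p" "p > 2" and inert: "Legendre (a\<^sup>2 + 4 * b) (int p) = -1"
  shows "[w p = a * w 0 - w 1] (mod int p)"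
proof -
  define N where "N = (\<lambda>v n. 2 * v (Suc n) - a * v n :: int)"
  define f where "f = (\<lambda>n k. 2 ^ n * (N ^^ k) w n)"
  define j where "j = (p - 1) div 2"
  have w': "w (Suc (Suc n)) = a * w (Suc n) + b * w n" for n using w[of n] by simp
  have "odd p" using p prime_odd_nat by auto
  then have pj: "p = Suc (2 * j)" by (auto simp: j_def elim: oddE)
  have NN: "N (N v) n = (a\<^sup>2 + 4 * b) * v n" if "\<And>n. v (n + 2) = a * v (n + 1) + b * v n" for v n
    using that[of n] by (simp add: N_def algebra_simps power2_eq_square)
  have even_pow: "(N ^^ (2 * i)) w n = (a\<^sup>2 + 4 * b) ^ i * w n" for i n
  proof (induction i arbitrary: n)
    case (Suc i)
    then have IH: "(N ^^ (2 * i)) w = (\<lambda>n. (a\<^sup>2 + 4 * b) ^ i * w n)" by blast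
    have "(N ^^ (2 * Suc i)) w n = N (N ((N ^^ (2 * i)) w)) n" by simp
    also have "\<dots> = (a\<^sup>2 + 4 * b) * ((a\<^sup>2 + 4 * b) ^ i * w n)"
      unfolding IH by (rule NN) (simp add: w' algebra_simps)
    finally show ?case by (simp add: mult_ac)
  qed simp
  have "(N ^^ p) w = N ((N ^^ (2 * j)) w)" by (simp add: pj)
  also have "(N ^^ (2 * j)) w = (\<lambda>n. (a\<^sup>2 + 4 * b) ^ j * w n)" using even_pow by blast
  finally have f0p: "f 0 p = (a\<^sup>2 + 4 * b) ^ j * (2 * w 1 - a * w 0)"
    by (simp add: f_def N_def algebra_simps)
  have f_rec: "f (Suc n) k = a * f n k + f n (Suc k)" for n k
    by (simp add: f_def N_def algebra_simps)
  have "f p 0 = 2 ^ p * w p" "f 0 0 = w 0" by (simp_all add: f_def)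
  with umbral_Frobenius[of f a p, OF f_rec p(1)] f0p
  have "[2 ^ p * w p = a ^ p * w 0 + (a\<^sup>2 + 4 * b) ^ j * (2 * w 1 - a * w 0)] (mod int p)" by simp
  moreover have "[2 * w p = 2 ^ p * w p] (mod int p)"
    by (intro cong_mult cong_sym[OF power_prime_cong_self[OF p]] cong_refl)
  moreover have "[a ^ p * w 0 + (a\<^sup>2 + 4 * b) ^ j * (2 * w 1 - a * w 0)
      = a * w 0 + (-1) * (2 * w 1 - a * w 0)] (mod int p)"
    using euler_criterion[OF p, of "a\<^sup>2 + 4 * b"] unfolding inert j_def
    by (intro cong_add cong_mult power_prime_cong_self[OF p] cong_refl) (rule cong_sym)
  ultimately have "[2 * w p = a * w 0 + (-1) * (2 * w 1 - a * w 0)] (mod int p)"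
    using cong_trans by blast
  then have "[2 * w p = 2 * (a * w 0 - w 1)] (mod int p)"
    by (simp add: algebra_simps)
  moreover have "coprime 2 (int p)" using \<open>odd p\<close> by simp
  ultimately show ?thesis using cong_mult_lcancel[of 2 "int p"] by blast
qed

section \<open>Necessity of the ratio condition\<close>

text \<open>
  The factor \<open>c\<^sup>2\<close> in \<open>D = \<Delta> c\<^sup>2\<close> guarantees that the prime \<open>p\<close> found for \<open>D\<close> does not divide \<open>c\<close>,
  while \<open>\<Delta>\<close> is still a non-residue modulo \<open>p\<close>.
\<close>

lemma ER_imp_initial_ratio:
  fixes u :: "nat \<Rightarrow> nat"
  assumes rec: "\<And>n. n \<ge> 1 \<Longrightarrow> int (u (n + 2)) = a * int (u (n + 1)) + b * int (u n)"
    and pos: "a\<^sup>2 + 4 * b > 0" and ns: "\<nexists>k. a\<^sup>2 + 4 * b = k\<^sup>2"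
    and ER: "u \<in> ER"
  shows "a * int (u 2) = (a\<^sup>2 + 2 * b) * int (u 1)"
proof (rule ccontr)
  define c where "c = a * int (u 2) - (a\<^sup>2 + 2 * b) * int (u 1)"
  assume "\<not> ?thesis"
  then have "c \<noteq> 0" by (simp add: c_def)
  define D where "D = nat ((a\<^sup>2 + 4 * b) * c\<^sup>2)"
  have D: "int D = (a\<^sup>2 + 4 * b) * c\<^sup>2" using pos by (simp add: D_def)
  have "\<nexists>k. D = k\<^sup>2"
  proof
    assume "\<exists>k. D = k\<^sup>2"
    then obtain k where "D = k\<^sup>2" by blast
    then have k: "(a\<^sup>2 + 4 * b) * c\<^sup>2 = (int k)\<^sup>2" using D by simp
    then have "c\<^sup>2 dvd (int k)\<^sup>2" by (metis dvd_triv_right)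
    then have "c dvd int k" by simp
    then obtain l where "int k = c * l" by blast
    then have "(a\<^sup>2 + 4 * b) = l\<^sup>2" using k \<open>c \<noteq> 0\<close> by (simp add: power_mult_distrib)
    then show False using ns by blast
  qed
  then obtain p where p: "prime p" "p > 2" "Legendre (int D) (int p) = -1"
    using exists_inert_prime_nat by blast
  have "Legendre (int D) (int p) =
      Legendre (a\<^sup>2 + 4 * b) (int p) * (Legendre c (int p) * Legendre c (int p))"
    unfolding D using Legendre_mult[OF p(1,2)] by (simp add: power2_eq_square)
  with p(3) have prod: "Legendre (a\<^sup>2 + 4 * b) (int p) * (Legendre c (int p) * Legendre c (int p)) = -1"
    by simp
  then have L1: "Legendre c (int p) \<noteq> 0" by auto
  then have "Legendre c (int p) * Legendre c (int p) = 1"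
    using Legendre_values[of c "int p"] by auto
  with prod have L2: "Legendre (a\<^sup>2 + 4 * b) (int p) = -1" by simp
  have 1: "[int (u (Suc p)) = a * int (u 1) - int (u 2)] (mod int p)"
    using recurrence_at_inert_prime[of "\<lambda>n. int (u (Suc n))" a b p] rec[of "Suc _"] p L2
    by (simp add: numeral_2_eq_2)
  have 2: "[int (u (Suc (Suc p))) = a * int (u 2) - int (u 3)] (mod int p)"
    using recurrence_at_inert_prime[of "\<lambda>n. int (u (Suc (Suc n)))" a b p] rec[of "Suc (Suc _)"] p L2
    by (simp add: numeral_2_eq_2 numeral_3_eq_3)
  \<comment> \<open>The congruence for inert primes determines the terms at \<open>p + 1\<close> and \<open>p + 2\<close>; the recurrence,
    read backwards, turns them into \<open>b u p \<equiv> a u 2 - (a\<^sup>2 + b) u 1\<close>.\<close>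
  have "int p dvd (int (u (Suc (Suc p))) - (a * int (u 2) - int (u 3)))
      - a * (int (u (Suc p)) - (a * int (u 1) - int (u 2)))"
    by (rule dvd_diff[OF 2[unfolded cong_iff_dvd_diff] dvd_mult[OF 1[unfolded cong_iff_dvd_diff]]])
  moreover have "int p dvd b * (int (u p) - int (u 1))"
    using ER_prime_congruence[OF ER p(1)] by simp
  moreover have "c = b * (int (u p) - int (u 1))
      - ((int (u (Suc (Suc p))) - (a * int (u 2) - int (u 3)))
      - a * (int (u (Suc p)) - (a * int (u 1) - int (u 2)))) "
    using rec[of p] rec[of 1] prime_gt_0_nat[OF p(1)]
    by (simp add: c_def algebra_simps power2_eq_square numeral_2_eq_2 numeral_3_eq_3)
  ultimately have "int p dvd c" by (metis dvd_diff)
  then show False using L1 by (simp add: Legendre_def cong_0_iff)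
qed

section \<open>The characterization\<close>

theorem theorem2p5:
  fixes a b :: int and u :: "nat \<Rightarrow> nat"
  assumes nonsquare: "\<nexists>k :: int. a^2 + 4 * b = k^2"
    and gcd1: "gcd a (a^2 + 2 * b) = 1"
    and u1: "u 1 \<ge> 1"
    and u2: "u 2 \<ge> 1"
    and recurrence: "\<forall>n\<ge>1. int (u (n + 2)) = a * int (u (n + 1)) + b * int (u n)"
  shows "u \<in> ER \<longleftrightarrow>
    (of_nat (u 2) / of_nat (u 1) :: rat) = of_int (a^2 + 2 * b) / of_int a"
proof -
  have rec: "int (u (n + 2)) = a * int (u (n + 1)) + b * int (u n)" if "n \<ge> 1" for n
    using recurrence that by blast
  have "a \<noteq> 0"
  proof
    assume "a = 0"
    then have "\<bar>2 * b\<bar> = 1" using gcd1 by simp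
    then show False by presburger
  qed
  have "b \<noteq> 0" using nonsquare by auto
  have "a\<^sup>2 + 4 * b \<ge> 0"
    using discriminant_nonneg[of "\<lambda>n. int (u n)" a b] rec u1 u2 by simp
  moreover have "a\<^sup>2 + 4 * b \<noteq> 0" using nonsquare by (metis zero_power2)
  ultimately have pos: "a\<^sup>2 + 4 * b > 0" by simp
  have ratio: "(of_nat (u 2) / of_nat (u 1) :: rat) = of_int (a^2 + 2 * b) / of_int a
      \<longleftrightarrow> a * int (u 2) = (a\<^sup>2 + 2 * b) * int (u 1)"
  proof -
    have "(of_nat (u 2) / of_nat (u 1) :: rat) = of_int (a^2 + 2 * b) / of_int a
        \<longleftrightarrow> (of_int (a * int (u 2)) :: rat) = of_int ((a\<^sup>2 + 2 * b) * int (u 1))"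
      using u1 \<open>a \<noteq> 0\<close> by (simp add: frac_eq_eq mult.commute)
    then show ?thesis by (simp only: of_int_eq_iff)
  qed
  have "u \<in> ER" if eq: "a * int (u 2) = (a\<^sup>2 + 2 * b) * int (u 1)"
  proof -
    have "a dvd (a\<^sup>2 + 2 * b) * int (u 1)" by (metis eq dvd_triv_left)
    then have "a dvd int (u 1)"
      using gcd1 by (metis coprime_iff_gcd_eq_1 coprime_dvd_mult_right_iff)
    then obtain k where "int (u 1) = a * k" by (elim dvdE)
    then have k: "int (u 1) = k * a" by (simp only: mult.commute)
    then have k2: "int (u 2) = k * (a\<^sup>2 + 2 * b)" using eq \<open>a \<noteq> 0\<close> by simp
    have "a\<^sup>2 + 2 * b > 0" using pos zero_le_power2[of a] by linarith
    moreover have "k * (a\<^sup>2 + 2 * b) > 0" "k * a > 0" using k k2 u1 u2 by simp_all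
    ultimately have "k > 0" "a > 0" by (auto simp: zero_less_mult_iff)
    show ?thesis using ER_of_trace_multiple[OF rec \<open>a > 0\<close> pos \<open>b \<noteq> 0\<close> k k2 \<open>k > 0\<close>] .
  qed
  then show ?thesis
    using ratio ER_imp_initial_ratio[OF rec pos nonsquare] by blast
qed

end
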